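(* Let $(b,T)$ be a uniform infinite treed bridge, and let $\Delta_0$ and $\Delta_0'$ be the associated random variables $$\Delta_0=\max_{i\in DS(b)\cap[0,H_1)}\Bigl(-\min_{u\in V(T(i))}\ell_i(u)\Bigr),\qquad \Delta'_0=\max_{i\in DS(b)\cap[H'_1,0)}\Bigl(-\min_{u\in V(T(i))}\ell_i(u)\Bigr).$$ Then for every $m\in\mathbb N$, $$\mathbb P(\Delta_0\ge m)=\frac1{m+1}\qquad\text{and}\qquad\mathbb P(\Delta_0'\ge m)=\frac1{m+3}.$$
   Context: Notation: $\mathbb N=\{1,2,\dots\}$, $\mathbb Z_+=\{0,1,2,\dots\}$, $\mathbb Z_-=\{\dots,-2,-1,0\}$. A well-labeled tree $(\tau,\ell)$ is a finite rooted plane tree $\tau$ with integer vertex labels $\ell$ such that labels of adjacent vertices differ by at most 1. For $k\in\mathbb Z$, $\rho_k$ is the probability measure on well-labeled trees with root label $k$ given by $\rho_k((\tau,\ell))=\tfrac12 12^{-|\tau|}$, where $|\tau|$ is the number of edges (equivalently: a Galton–Watson tree with geometric offspring distribution of parameter $1/2$, root label $k$, and i.i.d. uniform label increments in $\{-1,0,1\}$ along edges). A uniform infinite treed bridge $(b,T)$ is defined as follows. $b=(b(i):i\in\mathbb Z)$ is a two-sided simple symmetric random walk with $b(0)=0$ (the sides $i\ge0$ and $i\le0$ are independent simple symmetric random walks started from $0$). $DS(b)=\{i\in\mathbb Z:b(i+1)=b(i)-1\}$ is the set of down-steps. Conditionally on $b$, the $T(i)$, $i\in DS(b)$, are independent well-labeled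 trees, $T(i)$ having law $\rho_{b(i)}$; $\ell_i$ denotes the labeling of $T(i)$. $H_1=\inf\{m\in\mathbb Z_+:b(m)=-1\}$ and $H'_1=\sup\{m\in\mathbb Z_-:b(m)=-1\}$. The maximum over an empty set is $-\infty$. *)

theory Defs
  imports "HOL-Probability.Probability"
begin

datatype (vertex_labels: 'l) plane_tree =
  Node (root_label: 'l) (subtrees: "'l plane_tree list")

primrec num_edges :: "'l plane_tree \<Rightarrow> nat" where
  "num_edges (Node k ts) = sum_list (map (\<lambda>t. Suc (num_edges t)) ts)"

fun well_labeled :: "int plane_tree \<Rightarrow> bool" where
  "well_labeled (Node k ts) \<longleftrightarrow>
     (\<forall>t\<in>set ts. \<bar>root_label t - k\<bar> \<le> 1 \<and> well_labeled t)"

definition rho :: "int \<Rightarrow> int plane_tree measure" where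
  "rho k = density (count_space UNIV)
     (\<lambda>t. if well_labeled t \<and> root_label t = k
          then ennreal (1 / 2 * (1 / 12) ^ num_edges t) else 0)"

definition simple_random_walk :: "'a measure \<Rightarrow> ('a \<Rightarrow> nat \<Rightarrow> int) \<Rightarrow> bool" where
  "simple_random_walk M S \<longleftrightarrow>
     (AE \<omega> in M. S \<omega> 0 = 0) \<and>
     prob_space.indep_vars M (\<lambda>_. count_space UNIV) (\<lambda>n \<omega>. S \<omega> (Suc n) - S \<omega> n) UNIV \<and>
     (\<forall>n. distr M (count_space UNIV) (\<lambda>\<omega>. S \<omega> (Suc n) - S \<omega> n)
            = measure_pmf (pmf_of_set {-1, 1}))"

abbreviation path_space :: "('i \<Rightarrow> int) measure" where
  "path_space \<equiv> \<Pi>\<^sub>M i\<in>UNIV. count_space UNIV"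

definition two_sided_walk :: "'a measure \<Rightarrow> ('a \<Rightarrow> int \<Rightarrow> int) \<Rightarrow> bool" where
  "two_sided_walk M b \<longleftrightarrow>
     b \<in> M \<rightarrow>\<^sub>M path_space \<and>
     simple_random_walk M (\<lambda>\<omega> n. b \<omega> (int n)) \<and>
     simple_random_walk M (\<lambda>\<omega> n. b \<omega> (- int n)) \<and>
     prob_space.indep_var M
       path_space (\<lambda>\<omega> (n::nat). b \<omega> (int n)) path_space (\<lambda>\<omega> (n::nat). b \<omega> (- int n))"

definition DS :: "(int \<Rightarrow> int) \<Rightarrow> int set" where
  "DS w = {i. w (i + 1) = w i - 1}"

(* The last conjunct is conditional independence with prescribed conditional laws:
   given the sigma-algebra generated by b, on the event that all indices in the finite set J
   are down-steps, the trees T(i), i in J, have joint law the product of the rho (b(i)).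
   Off the down-steps T is only required to be measurable and carries no information used below. *)
definition uniform_infinite_treed_bridge ::
  "'a measure \<Rightarrow> ('a \<Rightarrow> int \<Rightarrow> int) \<Rightarrow> ('a \<Rightarrow> int \<Rightarrow> int plane_tree) \<Rightarrow> bool" where
  "uniform_infinite_treed_bridge M b T \<longleftrightarrow>
     prob_space M \<and> two_sided_walk M b \<and>
     (\<forall>i. (\<lambda>\<omega>. T \<omega> i) \<in> M \<rightarrow>\<^sub>M count_space UNIV) \<and>
     (\<forall>J A. finite J \<longrightarrow>
        (AE \<omega> in M. J \<subseteq> DS (b \<omega>) \<longrightarrow>
           real_cond_exp M (vimage_algebra (space M) b path_space)
             (indicator {\<omega> \<in> space M. \<forall>i\<in>J. T \<omega> i \<in> A i}) \<omega>
           = (\<Prod>i\<in>J. measure (rho (b \<omega> i)) (A i))))"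

(* Extended reals, so that H1 = \<infinity> and H1' = -\<infinity> if the level -1 is not hit. *)
definition H1 :: "(int \<Rightarrow> int) \<Rightarrow> ereal" where
  "H1 w = Inf {ereal (of_int m) | m. m \<ge> 0 \<and> w m = -1}"

definition H1' :: "(int \<Rightarrow> int) \<Rightarrow> ereal" where
  "H1' w = Sup {ereal (of_int m) | m. m \<le> 0 \<and> w m = -1}"

(* The maxima are suprema in the extended reals: the supremum of the empty set is -\<infinity>, and
   the index sets are finite except on the null event that the level -1 is not hit. *)
definition Delta0 :: "(int \<Rightarrow> int) \<Rightarrow> (int \<Rightarrow> int plane_tree) \<Rightarrow> ereal" where
  "Delta0 w t = (SUP i \<in> DS w \<inter> {i. 0 \<le> i \<and> ereal (of_int i) < H1 w}.
      ereal (of_int (- Min (vertex_labels (t i)))))"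

definition Delta0' :: "(int \<Rightarrow> int) \<Rightarrow> (int \<Rightarrow> int plane_tree) \<Rightarrow> ereal" where
  "Delta0' w t = (SUP i \<in> DS w \<inter> {i. H1' w \<le> ereal (of_int i) \<and> i < 0}.
      ereal (of_int (- Min (vertex_labels (t i)))))"

end

theory Submission imports Defs begin

text \<open>
  Let \<open>a k\<close> be the \<open>rho k\<close>-probability that all labels exceed \<open>c\<close>. Decomposing a tree at its root
  gives \<open>a k = 1 / (2 - (a (k - 1) + a k + a (k + 1)) / 3)\<close> for \<open>k > c\<close>, and \<open>a c = 0\<close>. The absolute
  difference of two \<open>[0, 1]\<close>-valued solutions is a bounded convex sequence vanishing at \<open>c\<close>, hence
  zero; so with \<open>j = k - c\<close> we have \<open>a k = j (j + 3) / ((j + 1) (j + 2))\<close>.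

  Given the bridge, the trees before the hitting of \<open>-1\<close> are independent, so the probability that all
  their labels exceed \<open>-m\<close> is the expectation over a simple random walk from \<open>0\<close> of a product of
  weights \<open>a\<close>, taken over the down-steps (from their upper end) of the forward walk and over the
  up-steps (again from their upper end) of the time-reversed walk. Started from \<open>x\<close>, this expectation
  satisfies a linear recursion in \<open>x\<close> solved by \<open>m / (m + x + 1)\<close> and by \<open>(m + 2) / (m + x + 3)\<close>,
  respectively; recurrence of the walk makes the bounded solution unique.
\<close>

subsection \<open>Trees with labels above a threshold\<close>

lemma nn_integral_prod_list_length:
  fixes g :: "'b \<Rightarrow> ennreal"
  shows "(\<integral>\<^sup>+ ts. prod_list (map g ts) * indicator {ts. length ts = n} ts \<partial>count_space UNIV)
    = (\<integral>\<^sup>+ t. g t \<partial>count_space UNIV) ^ n"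
proof (induction n)
  case 0
  have "(\<integral>\<^sup>+ ts. prod_list (map g ts) * indicator {ts. length ts = 0} ts \<partial>count_space UNIV)
     = (\<integral>\<^sup>+ ts. prod_list (map g ts) * indicator {[]} ts \<partial>count_space UNIV)"
    by (intro nn_integral_cong) (auto split: split_indicator)
  also have "\<dots> = 1"
    by (subst nn_integral_indicator_singleton) auto
  finally show ?case by simp
next
  case (Suc n)
  let ?c = "\<lambda>(t, ts). t # ts"
  let ?f = "\<lambda>ts. prod_list (map g ts) * indicator {ts. length ts = Suc n} ts"
  have bij: "bij_betw ?c (UNIV \<times> UNIV) (range ?c)"
    by (auto simp: bij_betw_def inj_on_def)
  have "(\<integral>\<^sup>+ ts. ?f ts \<partial>count_space UNIV) = (\<integral>\<^sup>+ ts. ?f ts \<partial>count_space (range ?c))"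
  proof (rule nn_integral_count_space_eq)
    fix ts :: "'b list" assume "ts \<in> UNIV - range ?c"
    then have "ts = []" by (cases ts) auto
    then show "?f ts = 0" by simp
  qed simp
  also have "\<dots> = (\<integral>\<^sup>+ p. ?f (?c p) \<partial>count_space (UNIV \<times> UNIV))"
    by (rule nn_integral_bij_count_space[OF bij, symmetric])
  also have "\<dots> = (\<integral>\<^sup>+ p. ?f (fst p # snd p) \<partial>count_space UNIV)"
    by (simp add: case_prod_beta)
  also have "\<dots> = (\<integral>\<^sup>+ t. \<integral>\<^sup>+ ts. ?f (t # ts) \<partial>count_space UNIV \<partial>count_space UNIV)"
    by (subst nn_integral_fst_count_space[symmetric]) simp
  also have "\<dots> = (\<integral>\<^sup>+ t. g t * (\<integral>\<^sup>+ ts. prod_list (map g ts) * indicator {ts. length ts = n} ts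
      \<partial>count_space UNIV) \<partial>count_space UNIV)"
    by (subst nn_integral_cmult[symmetric])
       (auto intro!: nn_integral_cong simp: mult.assoc split: split_indicator)
  also have "\<dots> = (\<integral>\<^sup>+ t. g t \<partial>count_space UNIV) ^ Suc n"
    by (simp add: Suc.IH nn_integral_multc)
  finally show ?case .
qed

text \<open>Splitting by length gives a geometric series in the total weight of one entry. Applied
  to the list of subtrees of a root, this is where the geometric offspring law enters.\<close>

lemma nn_integral_prod_list:
  fixes g :: "'b \<Rightarrow> ennreal"
  shows "(\<integral>\<^sup>+ ts. prod_list (map g ts) \<partial>count_space UNIV)
    = (\<Sum>n. (\<integral>\<^sup>+ t. g t \<partial>count_space UNIV) ^ n)"
proof -
  have "prod_list (map g ts) = (\<Sum>n. prod_list (map g ts) * indicator {ts. length ts = n} ts)" for ts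
  proof -
    have "(\<Sum>n. prod_list (map g ts) * indicator {ts. length ts = n} ts)
      = (\<Sum>n\<in>{length ts}. prod_list (map g ts) * indicator {ts. length ts = n} ts)"
      by (rule suminf_finite) auto
    then show ?thesis by simp
  qed
  then have "(\<integral>\<^sup>+ ts. prod_list (map g ts) \<partial>count_space UNIV)
    = (\<integral>\<^sup>+ ts. (\<Sum>n. prod_list (map g ts) * indicator {ts. length ts = n} ts) \<partial>count_space UNIV)"
    by (intro nn_integral_cong) auto
  also have "\<dots> = (\<Sum>n. \<integral>\<^sup>+ ts. prod_list (map g ts) * indicator {ts. length ts = n} ts \<partial>count_space UNIV)"
    by (rule nn_integral_suminf) simp
  finally show ?thesis by (simp only: nn_integral_prod_list_length)
qed

lemma suminf_power_ennreal:
  assumes "0 \<le> s" "s < 1"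
  shows "(\<Sum>n. ennreal s ^ n) = ennreal (1 / (1 - s))"
  unfolding ennreal_power[OF assms(1)]
  by (rule suminf_ennreal_eq) (use assms in \<open>auto intro: geometric_sums\<close>)

section \<open>Root decomposition of the tree measure\<close>

definition labels_above :: "int \<Rightarrow> int plane_tree set" where
  "labels_above c = {t. \<forall>x\<in>vertex_labels t. c < x}"

definition tree_weight :: "int \<Rightarrow> int \<Rightarrow> int plane_tree \<Rightarrow> ennreal" where
  "tree_weight c k t = (if well_labeled t \<and> root_label t = k \<and> t \<in> labels_above c
     then ennreal (1 / 2 * (1 / 12) ^ num_edges t) else 0)"

text \<open>The factor 1/6 combines the cost 1/12 of the edge to the parent with the removal of the
  factor 1/2 that \<open>tree_weight\<close> gives to the child as a root. The three summands are
  the possible label increments along that edge.\<close>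

abbreviation child_weight :: "int \<Rightarrow> int \<Rightarrow> int plane_tree \<Rightarrow> ennreal" where
  "child_weight c k t \<equiv>
     ennreal (1 / 6) * (tree_weight c (k - 1) t + tree_weight c k t + tree_weight c (k + 1) t)"

lemma emeasure_rho: "emeasure (rho k) (labels_above c) = (\<integral>\<^sup>+ t. tree_weight c k t \<partial>count_space UNIV)"
  unfolding rho_def
  by (subst emeasure_density) (auto simp: tree_weight_def intro!: nn_integral_cong split: split_indicator)

lemma child_weight_eq:
  "child_weight c k t = (if well_labeled t \<and> \<bar>root_label t - k\<bar> \<le> 1 \<and> t \<in> labels_above c
     then ennreal ((1 / 12) ^ Suc (num_edges t)) else 0)"
proof -
  consider "root_label t = k - 1" | "root_label t = k" | "root_label t = k + 1" | "\<bar>root_label t - k\<bar> > 1"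
    by linarith
  then show ?thesis
    by cases (auto simp: tree_weight_def ennreal_mult[symmetric])
qed

lemma prod_list_child_weight:
  "prod_list (map (child_weight c k) ts) =
    (if \<forall>t\<in>set ts. well_labeled t \<and> \<bar>root_label t - k\<bar> \<le> 1 \<and> t \<in> labels_above c
     then ennreal ((1 / 12) ^ (\<Sum>t\<leftarrow>ts. Suc (num_edges t))) else 0)"
  unfolding child_weight_eq
  by (induction ts) (auto simp add: power_add ennreal_mult[symmetric] algebra_simps)

text \<open>Edge numbers add up over the children and every label constraint concerns the root, one
  edge at the root or one subtree, so the weight factorizes over the list of subtrees.\<close>

lemma tree_weight_Node:
  "tree_weight c k (Node j ts) =
    (if j = k \<and> c < k then ennreal (1 / 2) * prod_list (map (child_weight c k) ts) else 0)"
  unfolding prod_list_child_weight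
  by (auto simp: tree_weight_def labels_above_def ennreal_mult'[symmetric] simp del: ennreal_half)

lemma nn_integral_root_label:
  assumes "\<And>j ts. j \<noteq> k \<Longrightarrow> f (Node j ts) = 0"
  shows "(\<integral>\<^sup>+ t. f t \<partial>count_space UNIV) = (\<integral>\<^sup>+ ts. f (Node k ts) \<partial>count_space UNIV)"
proof -
  have "bij_betw (Node k) UNIV (range (Node k))" by (auto simp: bij_betw_def inj_on_def)
  from nn_integral_bij_count_space[OF this, of f] 
  have "(\<integral>\<^sup>+ ts. f (Node k ts) \<partial>count_space UNIV) = (\<integral>\<^sup>+ t. f t \<partial>count_space (range (Node k)))" .
  also have "\<dots> = (\<integral>\<^sup>+ t. f t \<partial>count_space UNIV)"
  proof (rule nn_integral_count_space_eq)
    fix t assume "t \<in> UNIV - range (Node k)"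
    then show "f t = 0" using assms by (cases t) auto
  qed simp
  finally show ?thesis by simp
qed

text \<open>An a priori bound, which makes the masses real numbers and the geometric series
  convergent. It is proved for trees with fewer than \<open>h\<close> edges by induction on
  \<open>h\<close>: if these have mass at most 1, one child has total weight at most 1/2, and half
  the geometric series of ratio 1/2 is again 1. Monotone convergence then removes the
  truncation.\<close>

lemma nn_integral_tree_weight_le_1: "(\<integral>\<^sup>+ t. tree_weight c k t \<partial>count_space UNIV) \<le> 1"
proof -
  define g where "g h k t = tree_weight c k t * indicator {t. num_edges t < h} t" for h k t
  have bound: "(\<integral>\<^sup>+ t. g h k t \<partial>count_space UNIV) \<le> 1" for h k
  proof (induction h arbitrary: k)
    case 0
    then show ?case by (simp add: g_def)
  next
    case (Suc h)
    let ?q = "\<lambda>t. ennreal (1 / 6) * (g h (k - 1) t + g h k t + g h (k + 1) t)"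
    have q: "?q t = child_weight c k t * indicator {t. num_edges t < h} t" for t
      by (simp add: g_def split: split_indicator)
    \<comment> \<open>Only an inequality: on the right each child is truncated separately, so lists
      of subtrees whose total edge number exceeds the bound are also counted.\<close>
    have g_Node: "g (Suc h) k (Node k ts) \<le> ennreal (1 / 2) * prod_list (map ?q ts)" for ts
    proof (cases "num_edges (Node k ts) < Suc h")
      case True
      have "num_edges t < h" if "t \<in> set ts" for t
        using member_le_sum_list[of "Suc (num_edges t)" "map (\<lambda>t. Suc (num_edges t)) ts"] that True by auto
      then have "prod_list (map ?q ts) = prod_list (map (child_weight c k) ts)"
        by (intro arg_cong[of _ _ prod_list] map_cong refl) (simp add: q)
      then show ?thesis
        by (auto simp: g_def tree_weight_Node split: split_indicator)
    qed (simp add: g_def)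
    have "(\<integral>\<^sup>+ t. ?q t \<partial>count_space UNIV) = ennreal (1 / 6) * ((\<integral>\<^sup>+ t. g h (k - 1) t \<partial>count_space UNIV) +
       (\<integral>\<^sup>+ t. g h k t \<partial>count_space UNIV) + (\<integral>\<^sup>+ t. g h (k + 1) t \<partial>count_space UNIV))"
      by (simp add: nn_integral_cmult nn_integral_add)
    also have "\<dots> \<le> ennreal (1 / 6) * (1 + 1 + 1)"
      by (intro mult_left_mono add_mono Suc.IH) simp
    also have "\<dots> = ennreal (1 / 2)" 
    proof -
      have "(1 + 1 + 1 :: ennreal) = ennreal 3" by simp
      then show ?thesis by (simp only: ennreal_mult[symmetric]) simp
    qed
    finally have q_le: "(\<integral>\<^sup>+ t. ?q t \<partial>count_space UNIV) \<le> ennreal (1 / 2)" .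
    have "(\<integral>\<^sup>+ t. g (Suc h) k t \<partial>count_space UNIV) = (\<integral>\<^sup>+ ts. g (Suc h) k (Node k ts) \<partial>count_space UNIV)"
      by (rule nn_integral_root_label) (simp add: g_def tree_weight_Node)
    also have "\<dots> \<le> (\<integral>\<^sup>+ ts. ennreal (1 / 2) * prod_list (map ?q ts) \<partial>count_space UNIV)"
      by (intro nn_integral_mono g_Node)
    also have "\<dots> = ennreal (1 / 2) * (\<Sum>n. (\<integral>\<^sup>+ t. ?q t \<partial>count_space UNIV) ^ n)"
      by (subst nn_integral_cmult) (simp_all only: nn_integral_prod_list borel_measurable_count_space)
    also have "\<dots> \<le> ennreal (1 / 2) * (\<Sum>n. ennreal (1 / 2) ^ n)"
      by (intro mult_left_mono suminf_le power_mono q_le summableI zero_le)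
    also have "(\<Sum>n. ennreal (1 / 2) ^ n) = ennreal 2"
      using suminf_power_ennreal[of "1 / 2"] by (simp del: ennreal_half)
    also have "ennreal (1 / 2) * ennreal 2 = 1"
      by (subst ennreal_mult[symmetric]) simp_all
    finally show ?case .
  qed
  have "(\<integral>\<^sup>+ t. tree_weight c k t \<partial>count_space UNIV) = (\<integral>\<^sup>+ t. (SUP h. g h k t) \<partial>count_space UNIV)"
  proof (intro nn_integral_cong antisym)
    fix t show "tree_weight c k t \<le> (SUP h. g h k t)"
      by (rule SUP_upper2[of "Suc (num_edges t)"]) (auto simp: g_def)
    show "(SUP h. g h k t) \<le> tree_weight c k t"
      by (rule SUP_least) (auto simp: g_def split: split_indicator)
  qed
  also have "\<dots> = (SUP h. \<integral>\<^sup>+ t. g h k t \<partial>count_space UNIV)"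
    by (rule nn_integral_monotone_convergence_SUP)
       (auto simp: incseq_def le_fun_def g_def split: split_indicator)
  also have "\<dots> \<le> 1"
    by (rule SUP_least) (rule bound)
  finally show ?thesis .
qed

lemma rho_labels_above_bounds:
  "emeasure (rho k) (labels_above c) = ennreal (measure (rho k) (labels_above c))"
  "0 \<le> measure (rho k) (labels_above c)" "measure (rho k) (labels_above c) \<le> 1"
proof -
  have le: "emeasure (rho k) (labels_above c) \<le> 1"
    by (simp add: emeasure_rho nn_integral_tree_weight_le_1)
  then show eq: "emeasure (rho k) (labels_above c) = ennreal (measure (rho k) (labels_above c))"
    by (intro emeasure_eq_ennreal_measure) (auto simp: top_unique)
  show "measure (rho k) (labels_above c) \<le> 1" using le unfolding eq by (simp only: ennreal_le_1)
qed simp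

lemma rho_labels_above_eq_0: "measure (rho k) (labels_above c) = 0" if "k \<le> c"
proof -
  have "tree_weight c k t = 0" for t
    using that by (cases t) (simp add: tree_weight_Node)
  then show ?thesis by (simp add: measure_def emeasure_rho)
qed

text \<open>By the root decomposition the mass is half a geometric series in the total weight
  \<open>s\<close> of one child, and \<open>s\<close> is half the average of the three masses at the
  possible child labels.\<close>

lemma rho_labels_above_rec:
  assumes "c < k"
  defines "a \<equiv> \<lambda>k. measure (rho k) (labels_above c)"
  shows "a k = 1 / (2 - (a (k - 1) + a k + a (k + 1)) / 3)"
proof -
  define s where "s = (a (k - 1) + a k + a (k + 1)) / 6"
  have s: "0 \<le> s" "s \<le> 1 / 2"
    using rho_labels_above_bounds(2,3)[of "k - 1" c] rho_labels_above_bounds(2,3)[of k c]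
      rho_labels_above_bounds(2,3)[of "k + 1" c] by (auto simp: s_def a_def)
  have I: "(\<integral>\<^sup>+ t. tree_weight c j t \<partial>count_space UNIV) = ennreal (a j)" for j
    using rho_labels_above_bounds(1)[of j c] by (simp add: emeasure_rho a_def)
  have q: "(\<integral>\<^sup>+ t. child_weight c k t \<partial>count_space UNIV) = ennreal s"
  proof -
    have "(\<integral>\<^sup>+ t. child_weight c k t \<partial>count_space UNIV) = ennreal (1 / 6) * (ennreal (a (k - 1)) + ennreal (a k) + ennreal (a (k + 1)))"
      by (simp add: nn_integral_cmult nn_integral_add I)
    also have "\<dots> = ennreal (1 / 6) * ennreal (a (k - 1) + a k + a (k + 1))"
      by (simp add: a_def ennreal_plus)
    also have "\<dots> = ennreal s"
      by (subst ennreal_mult[symmetric]) (auto simp: a_def s_def)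
    finally show ?thesis .
  qed
  have "ennreal (a k) = (\<integral>\<^sup>+ ts. ennreal (1 / 2) * prod_list (map (child_weight c k) ts) \<partial>count_space UNIV)"
    unfolding I[symmetric] using assms(1) by (subst nn_integral_root_label[of k]) (simp_all add: tree_weight_Node)
  also have "\<dots> = ennreal (1 / 2) * (\<Sum>n. ennreal s ^ n)"
    by (subst nn_integral_cmult) (simp_all only: nn_integral_prod_list borel_measurable_count_space q)
  also have "(\<Sum>n. ennreal s ^ n) = ennreal (1 / (1 - s))"
    using s by (intro suminf_power_ennreal) auto
  also have "ennreal (1 / 2) * ennreal (1 / (1 - s)) = ennreal (1 / 2 * (1 / (1 - s)))"
    using s by (intro ennreal_mult[symmetric]) auto
  finally have "a k = 1 / 2 * (1 / (1 - s))"
    using s by (subst (asm) ennreal_inj) (auto simp: a_def)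
  then show ?thesis using s by (simp add: s_def field_simps)
qed

text \<open>Increments of a convex sequence never decrease, so a single positive increment
  \<open>e\<close> would force linear growth at rate \<open>e\<close> and contradict
  boundedness.\<close>

lemma bounded_convex_sequence_le:
  fixes d :: "nat \<Rightarrow> real"
  assumes convex: "\<And>j. 2 * d (Suc j) \<le> d j + d (Suc (Suc j))" and bdd: "\<And>j. d j \<le> C"
  shows "d (Suc j) \<le> d j"
proof (rule ccontr)
  define e where "e = d (Suc j) - d j"
  assume "\<not> d (Suc j) \<le> d j"
  then have e: "e > 0" by (simp add: e_def)
  have inc: "e \<le> d (Suc (j + n)) - d (j + n)" for n
  proof (induction n)
    case (Suc n)
    then show ?case using convex[of "j + n"] by simp
  qed (simp add: e_def)
  have grow: "d j + real n * e \<le> d (j + n)" for n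
  proof (induction n)
    case (Suc n)
    then show ?case using inc[of n] by (simp add: algebra_simps)
  qed simp
  obtain n where "C - d j < real n * e" using reals_Archimedean3[OF e] by blast
  then show False using grow[of n] bdd[of "j + n"] by linarith
qed

lemma rho_labels_above:
  assumes "c \<le> k"
  shows "measure (rho k) (labels_above c) =
    of_int ((k - c) * (k - c + 3)) / of_int ((k - c + 1) * (k - c + 2))"
proof -
  define a where "a j = measure (rho (c + int j)) (labels_above c)" for j
  define p where "p j = real j * (real j + 3) / ((real j + 1) * (real j + 2))" for j
  define d where "d j = \<bar>a j - p j\<bar>" for j
  have a01: "0 \<le> a j" "a j \<le> 1" for j
    unfolding a_def by (rule rho_labels_above_bounds)+
  have p01: "0 \<le> p j" "p j \<le> 1" for j
    using mult_nonneg_nonneg[of "real j" "real j"]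
    by (simp_all add: p_def divide_simps algebra_simps not_less add_nonneg_nonneg)
  have a_rec: "a (Suc j) = 1 / (2 - (a j + a (Suc j) + a (Suc (Suc j))) / 3)" for j
  proof -
    have "c + int (Suc j) - 1 = c + int j" "c + int (Suc j) + 1 = c + int (Suc (Suc j))" by simp_all
    then show ?thesis using rho_labels_above_rec[of c "c + int (Suc j)"] by (simp only: a_def)
  qed
  have p_rec: "p (Suc j) = 1 / (2 - (p j + p (Suc j) + p (Suc (Suc j))) / 3)" for j
  proof -
    define x where "x = real j"
    have x: "x \<ge> 0" by (simp add: x_def)
    have "2 - (p j + p (Suc j) + p (Suc (Suc j))) / 3 = (x + 2) * (x + 3) / ((x + 1) * (x + 4))"
      using x unfolding p_def of_nat_Suc x_def[symmetric]
      by (simp add: divide_simps add_nonneg_eq_0_iff) algebra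
    moreover have "p (Suc j) = (x + 1) * (x + 4) / ((x + 2) * (x + 3))"
      unfolding p_def of_nat_Suc x_def[symmetric] by (simp add: algebra_simps)
    ultimately show ?thesis by simp
  qed
  have d_conv: "2 * d (Suc j) \<le> d j + d (Suc (Suc j))" for j
  proof -
    \<comment> \<open>The averaged values lie in [0, 1], so \<open>A\<close> and \<open>B\<close>
      are at least 1, where taking reciprocals is 1-Lipschitz. Hence \<open>d (Suc j)\<close> is at
      most the average of \<open>d\<close> at \<open>j\<close>, \<open>Suc j\<close> and
      \<open>Suc (Suc j)\<close>, which rearranges to convexity.\<close>
    define A B where "A = 2 - (a j + a (Suc j) + a (Suc (Suc j))) / 3"
      and "B = 2 - (p j + p (Suc j) + p (Suc (Suc j))) / 3"
    have AB: "A \<ge> 1" "B \<ge> 1"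
      using a01[of j] a01[of "Suc j"] a01[of "Suc (Suc j)"] p01[of j] p01[of "Suc j"] p01[of "Suc (Suc j)"]
      by (auto simp: A_def B_def)
    have "a (Suc j) - p (Suc j) = 1 / A - 1 / B" using a_rec p_rec by (simp add: A_def B_def)
    also have "\<dots> = (B - A) / (A * B)" using AB by (simp add: field_simps)
    finally have "d (Suc j) = \<bar>B - A\<bar> / (A * B)" using AB by (simp add: d_def)
    also have "\<dots> \<le> \<bar>B - A\<bar> / 1"
      using AB mult_mono[of 1 A 1 B] by (intro divide_left_mono) auto
    also have "\<dots> \<le> (d j + d (Suc j) + d (Suc (Suc j))) / 3"
    proof -
      have "B - A = ((a j - p j) + (a (Suc j) - p (Suc j)) + (a (Suc (Suc j)) - p (Suc (Suc j)))) / 3"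
        by (simp add: A_def B_def diff_divide_distrib add_divide_distrib)
      moreover have "\<bar>(x + y + z) / 3\<bar> \<le> (\<bar>x\<bar> + \<bar>y\<bar> + \<bar>z\<bar>) / 3" for x y z :: real
        unfolding abs_divide abs_numeral by (intro divide_right_mono) linarith+
      ultimately show ?thesis by (simp only: d_def div_by_1)
    qed
    finally show ?thesis by simp
  qed
  have d_bdd: "d j \<le> 1" for j using a01[of j] p01[of j] by (auto simp: d_def)
  have "d j \<le> d 0" for j
  proof (induction j)
    case (Suc j)
    have "d (Suc j) \<le> d j" by (rule bounded_convex_sequence_le[of d 1]) (rule d_conv d_bdd)+
    then show ?case using Suc by linarith
  qed simp
  \<comment> \<open>A root with label \<open>c\<close> already violates the threshold, and the
    closed form vanishes there too. Since \<open>d\<close> is nonnegative and bounded by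
    \<open>d 0\<close>, it is zero throughout.\<close>
  moreover have "d 0 = 0"
    using rho_labels_above_eq_0[of c c] by (simp add: d_def a_def p_def)
  ultimately have "a j = p j" for j by (smt (verit) d_def)
  from this[of "nat (k - c)"] show ?thesis using assms by (simp add: a_def p_def)
qed

subsection \<open>Weighted hitting probabilities\<close>

text \<open>First-step recursion for the simple random walk from \<open>x\<close>: the expectation,
  on the event that -1 is hit within \<open>n\<close> steps, of the product of \<open>w\<close> over
  the steps made before the hit. With \<open>w\<close> constantly 1 it is the hitting probability
  itself.\<close>

primrec hit_weight :: "(int \<Rightarrow> int \<Rightarrow> real) \<Rightarrow> nat \<Rightarrow> int \<Rightarrow> real" where
  "hit_weight w 0 x = (if x = -1 then 1 else 0)"
| "hit_weight w (Suc n) x = (if x = -1 then 1 else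
     (w x (x + 1) * hit_weight w n (x + 1) + w x (x - 1) * hit_weight w n (x - 1)) / 2)"

lemma hit_weight_at_target [simp]: "hit_weight w n (-1) = 1"
  by (cases n) auto

lemma hit_weight_1_bounds: "0 \<le> hit_weight (\<lambda>_ _. 1) n x" "hit_weight (\<lambda>_ _. 1) n x \<le> 1"
proof -
  have "0 \<le> hit_weight (\<lambda>_ _. 1) n x \<and> hit_weight (\<lambda>_ _. 1) n x \<le> 1"
  proof (induction n arbitrary: x)
    case (Suc n)
    from Suc[of "x + 1"] Suc[of "x - 1"] show ?case by auto
  qed simp
  then show "0 \<le> hit_weight (\<lambda>_ _. 1) n x" "hit_weight (\<lambda>_ _. 1) n x \<le> 1" by auto
qed

lemma hit_weight_1_mono: "hit_weight (\<lambda>_ _. 1) n x \<le> hit_weight (\<lambda>_ _. 1) (Suc n) x"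
proof (induction n arbitrary: x)
  case 0
  then show ?case using hit_weight_1_bounds(1) by auto
next
  case (Suc n)
  from Suc[of "x + 1"] Suc[of "x - 1"] show ?case
    by (simp only: hit_weight.simps(2)[of _ n] hit_weight.simps(2)[of _ "Suc n"]) auto
qed

text \<open>Recurrence of the walk: the limit is harmonic on the nonnegative integers, hence affine
  from -1 onwards, and a bounded affine function with value 1 at -1 is constant.\<close>

lemma hit_weight_1_tendsto:
  assumes "x \<ge> -1"
  shows "(\<lambda>n. hit_weight (\<lambda>_ _. 1) n x) \<longlonglongrightarrow> 1"
proof -
  define q where "q x = lim (\<lambda>n. hit_weight (\<lambda>_ _. 1) n x)" for x
  have lim: "(\<lambda>n. hit_weight (\<lambda>_ _. 1) n x) \<longlonglongrightarrow> q x" for x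
    unfolding q_def convergent_LIMSEQ_iff[symmetric]
    by (rule Bseq_mono_convergent)
       (auto intro!: BseqI'[of _ 1] lift_Suc_mono_le[of "\<lambda>n. hit_weight (\<lambda>_ _. 1) n x"] hit_weight_1_mono
         simp: abs_of_nonneg hit_weight_1_bounds simp del: hit_weight.simps)
  have q01: "0 \<le> q x" "q x \<le> 1" for x
    using LIMSEQ_le_const[OF lim] LIMSEQ_le_const2[OF lim] hit_weight_1_bounds by blast+
  have harmonic: "2 * q x = q (x + 1) + q (x - 1)" if "x \<ge> 0" for x
  proof -
    have "(\<lambda>n. hit_weight (\<lambda>_ _. 1) (Suc n) x) \<longlonglongrightarrow> (q (x + 1) + q (x - 1)) / 2"
      using that by (auto intro!: tendsto_intros lim)
    from LIMSEQ_unique[OF this LIMSEQ_Suc[OF lim]] show ?thesis by simp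
  qed
  have q_neg1: "q (-1) = 1"
    by (simp add: q_def)
  \<comment> \<open>The harmonic relation is of second order, so the induction carries two
    consecutive values.\<close>
  have q_lin: "1 - q (int n - 1) = real n * (1 - q 0) \<and> 1 - q (int n) = (real n + 1) * (1 - q 0)" for n
  proof (induction n)
    case (Suc n)
    then show ?case using harmonic[of "int n"] by (simp add: algebra_simps)
  qed (simp add: q_neg1)
  have "q 0 = 1"
  proof (rule ccontr)
    assume "q 0 \<noteq> 1"
    then have pos: "1 - q 0 > 0" using q01(2)[of 0] by simp
    obtain n where "1 < real n * (1 - q 0)" using reals_Archimedean3[OF pos] by blast
    then show False using q_lin[of n] q01(1)[of "int n - 1"] by simp
  qed
  then have "q x = 1" using q_lin[of "nat (x + 1)"] assms by simp
  then show ?thesis using lim[of x] by simp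
qed

text \<open>
  The defect \<open>h x - hit_weight w n x\<close> of the candidate \<open>h\<close> is at most the probability that
  the unweighted walk has not yet hit \<open>-1\<close>.
\<close>
lemma hit_weight_tendsto:
  assumes w: "\<And>x y. 0 \<le> w x y" "\<And>x y. w x y \<le> 1"
    and h: "\<And>x. x \<ge> -1 \<Longrightarrow> 0 \<le> h x" "\<And>x. x \<ge> -1 \<Longrightarrow> h x \<le> 1" "h (-1) = 1"
    and h_rec: "\<And>x. x \<ge> 0 \<Longrightarrow> h x = (w x (x + 1) * h (x + 1) + w x (x - 1) * h (x - 1)) / 2"
    and x: "x \<ge> -1"
  shows "(\<lambda>n. hit_weight w n x) \<longlonglongrightarrow> h x"
proof -
  have sandwich: "0 \<le> h x - hit_weight w n x \<and> h x - hit_weight w n x \<le> 1 - hit_weight (\<lambda>_ _. 1) n x"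
    if "x \<ge> -1" for n x
    using that
  proof (induction n arbitrary: x)
    case 0
    then show ?case using h by auto
  next
    case (Suc n)
    show ?case
    proof (cases "x = -1")
      case False
      then have x: "x \<ge> 0" using Suc.prems by simp
      \<comment> \<open>The defect \<open>d\<close> obeys the weighted recursion and
        \<open>e\<close> the unweighted one; since the weights lie in [0, 1], the bounds
        \<open>0 \<le> d \<le> e\<close> pass to the next step.\<close>
      define d e where "d y = h y - hit_weight w n y" and "e y = 1 - hit_weight (\<lambda>_ _. 1) n y" for y
      have "0 \<le> d y \<and> d y \<le> e y" if "y \<ge> -1" for y
        using Suc.IH[OF that] by (simp add: d_def e_def)
      then have "0 \<le> w x y * d y \<and> w x y * d y \<le> e y" if "y \<ge> -1" for y
        using that w[of x y] mult_mono[of "w x y" 1 "d y" "e y"] by force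
      from this[of "x + 1"] this[of "x - 1"] x False show ?thesis
        by (auto simp: h_rec[of x] d_def e_def field_simps)
    qed (simp add: h)
  qed
  have "(\<lambda>n. h x - hit_weight w n x) \<longlonglongrightarrow> 0"
  proof (rule tendsto_sandwich[OF _ _ tendsto_const])
    show "(\<lambda>n. 1 - hit_weight (\<lambda>_ _. 1) n x) \<longlonglongrightarrow> 0"
      using tendsto_diff[OF tendsto_const hit_weight_1_tendsto[OF x], of 1] by simp
  qed (use sandwich[OF x] in \<open>auto intro!: always_eventually\<close>)
  from tendsto_diff[OF tendsto_const this, of "h x"] show ?thesis by simp
qed

section \<open>Cylinder events of the walk and events up to its first visit to -1\<close>

definition cylinder :: "'a measure \<Rightarrow> ('a \<Rightarrow> nat \<Rightarrow> int) \<Rightarrow> (nat \<Rightarrow> int) \<Rightarrow> nat \<Rightarrow> 'a set" where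
  "cylinder M S s l = {\<omega> \<in> space M. \<forall>k\<le>l. S \<omega> k = s k}"

definition walk_path :: "(nat \<Rightarrow> int) \<Rightarrow> nat \<Rightarrow> bool" where
  "walk_path s l \<longleftrightarrow> s 0 = 0 \<and> (\<forall>k<l. \<bar>s (Suc k) - s k\<bar> = 1)"

context prob_space
begin

lemma simple_random_walk_step:
  assumes "simple_random_walk M S"
  shows "AE \<omega> in M. \<forall>n. \<bar>S \<omega> (Suc n) - S \<omega> n\<bar> = 1"
    and "\<bar>e\<bar> = 1 \<Longrightarrow> prob {\<omega> \<in> space M. S \<omega> (Suc n) - S \<omega> n = e} = 1 / 2"
proof -
  have X: "(\<lambda>\<omega>. S \<omega> (Suc n) - S \<omega> n) \<in> M \<rightarrow>\<^sub>M count_space UNIV" for n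
    using assms by (auto simp: simple_random_walk_def indep_vars_def)
  have distr: "distr M (count_space UNIV) (\<lambda>\<omega>. S \<omega> (Suc n) - S \<omega> n) = measure_pmf (pmf_of_set {-1, 1})" for n
    using assms by (simp add: simple_random_walk_def)
  have "AE e in distr M (count_space UNIV) (\<lambda>\<omega>. S \<omega> (Suc n) - S \<omega> n). \<bar>e\<bar> = 1" for n
    unfolding distr by (auto simp: AE_measure_pmf_iff)
  then show "AE \<omega> in M. \<forall>n. \<bar>S \<omega> (Suc n) - S \<omega> n\<bar> = 1"
    unfolding AE_all_countable using AE_distrD[OF X] by blast
  assume "\<bar>e\<bar> = 1"
  then have "e \<in> {-1, 1}" by auto
  have "prob {\<omega> \<in> space M. S \<omega> (Suc n) - S \<omega> n = e}
    = measure (distr M (count_space UNIV) (\<lambda>\<omega>. S \<omega> (Suc n) - S \<omega> n)) {e}"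
    by (subst measure_distr[OF X]) (auto intro!: arg_cong[of _ _ prob])
  also have "\<dots> = 1 / 2"
    using \<open>e \<in> {-1, 1}\<close> by (auto simp: distr measure_pmf_single)
  finally show "prob {\<omega> \<in> space M. S \<omega> (Suc n) - S \<omega> n = e} = 1 / 2" .
qed

lemma prob_cylinder:
  assumes S: "simple_random_walk M S" and [measurable]: "\<And>k. (\<lambda>\<omega>. S \<omega> k) \<in> M \<rightarrow>\<^sub>M count_space UNIV"
    and s: "walk_path s l"
  shows "prob (cylinder M S s l) = (1 / 2) ^ l"
proof -
  define X where "X n \<omega> = S \<omega> (Suc n) - S \<omega> n" for n \<omega>
  define B where "B k = {\<omega> \<in> space M. X k \<omega> = s (Suc k) - s k}" for k
  have indep: "indep_vars (\<lambda>_. count_space UNIV) X UNIV"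
    using S by (simp add: simple_random_walk_def X_def[abs_def])
  then have [measurable]: "X k \<in> M \<rightarrow>\<^sub>M count_space UNIV" for k
    by (simp add: indep_vars_def)
  have B_vimage: "B k = X k -` {s (Suc k) - s k} \<inter> space M" for k
    by (auto simp: B_def)
  have S0: "AE \<omega> in M. S \<omega> 0 = 0" using S by (simp add: simple_random_walk_def)
  have cyl_iff: "\<omega> \<in> cylinder M S s l \<longleftrightarrow> \<omega> \<in> space M \<and> (\<forall>k<l. \<omega> \<in> B k)"
    if "S \<omega> 0 = 0" for \<omega>
  proof -
    have "(\<forall>k\<le>l. S \<omega> k = s k) \<longleftrightarrow> (\<forall>k<l. X k \<omega> = s (Suc k) - s k)"
    proof (intro iffI allI impI)
      assume R: "\<forall>k<l. X k \<omega> = s (Suc k) - s k"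
      fix k show "k \<le> l \<Longrightarrow> S \<omega> k = s k"
      proof (induction k)
        case 0
        then show ?case using that s by (simp add: walk_path_def)
      next
        case (Suc k)
        then show ?case using R[rule_format, of k] by (simp add: X_def)
      qed
    qed (auto simp: X_def)
    then show ?thesis by (auto simp: cylinder_def B_def)
  qed
  show ?thesis
  \<comment> \<open>The product formula for independent variables is applied to a nonempty index
    set, so the path without steps is treated apart.\<close>
  proof (cases "l = 0")
    case True
    then have "prob (cylinder M S s l) = 1"
      using S0 s unfolding cylinder_def walk_path_def by (subst prob_Collect_eq_1) auto
    then show ?thesis using True by simp
  next
    case False
    have "prob (cylinder M S s l) = prob (\<Inter>k\<in>{..<l}. X k -` {s (Suc k) - s k} \<inter> space M)"
    proof (rule finite_measure_eq_AE)
      show "AE \<omega> in M. \<omega> \<in> cylinder M S s l \<longleftrightarrow> \<omega> \<in> (\<Inter>k\<in>{..<l}. X k -` {s (Suc k) - s k} \<inter> space M)"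
        using S0 by eventually_elim (use False in \<open>auto simp: cyl_iff B_vimage\<close>)
      show "cylinder M S s l \<in> events" unfolding cylinder_def by measurable
      show "(\<Inter>k\<in>{..<l}. X k -` {s (Suc k) - s k} \<inter> space M) \<in> events"
        using False by (intro sets.finite_INT) auto
    qed
    also have "\<dots> = (\<Prod>k\<in>{..<l}. prob (X k -` {s (Suc k) - s k} \<inter> space M))"
      using False by (intro indep_varsD[OF indep]) auto
    also have "\<dots> = (\<Prod>k\<in>{..<l}. 1 / 2)"
    proof (intro prod.cong refl)
      fix k assume "k \<in> {..<l}"
      then have "\<bar>s (Suc k) - s k\<bar> = 1" using s by (simp add: walk_path_def)
      from simple_random_walk_step(2)[OF S this, of k]
      show "prob (X k -` {s (Suc k) - s k} \<inter> space M) = 1 / 2"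
        by (simp add: B_vimage[symmetric] B_def X_def)
    qed
    finally show ?thesis by simp
  qed
qed

text \<open>\<open>G k\<close> stands for a good tree at step \<open>k\<close>. Such events involve
  more than the walk, so the induction on the remaining number \<open>n\<close> of steps keeps the
  whole prefix \<open>s\<close> prescribed and lengthens it by one step; \<open>weight\<close>
  evaluates the joint probability once the prefix reaches its end. The two possible next steps
  reproduce the recursion of \<open>hit_weight\<close>.\<close>

lemma prob_cylinder_hit:
  assumes S: "simple_random_walk M S"
    and [measurable]: "\<And>k. (\<lambda>\<omega>. S \<omega> k) \<in> M \<rightarrow>\<^sub>M count_space UNIV" "\<And>k. Measurable.pred M (G k)"
    and weight: "\<And>s l. walk_path s l \<Longrightarrow>
      \<P>(\<omega> in M. (\<forall>k\<le>l. S \<omega> k = s k) \<and> (\<forall>k<l. G k \<omega>)) = (1 / 2) ^ l * (\<Prod>k<l. w (s k) (s (Suc k)))"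
    and s: "walk_path s l" "\<And>k. k < l \<Longrightarrow> s k \<noteq> -1"
  shows "\<P>(\<omega> in M. (\<forall>k\<le>l. S \<omega> k = s k) \<and>
      (\<exists>\<tau>\<in>{l..l + n}. S \<omega> \<tau> = -1 \<and> (\<forall>k<\<tau>. S \<omega> k \<noteq> -1 \<and> G k \<omega>)))
    = (1 / 2) ^ l * (\<Prod>k<l. w (s k) (s (Suc k))) * hit_weight w n (s l)"
  using s
proof (induction n arbitrary: s l)
  case (0 s l)
  have "(\<forall>k\<le>l. S \<omega> k = s k) \<and> (\<exists>\<tau>\<in>{l..l + 0}. S \<omega> \<tau> = -1 \<and> (\<forall>k<\<tau>. S \<omega> k \<noteq> -1 \<and> G k \<omega>))
    \<longleftrightarrow> s l = -1 \<and> (\<forall>k\<le>l. S \<omega> k = s k) \<and> (\<forall>k<l. G k \<omega>)" for \<omega>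
    using 0(2) by auto
  then show ?case using weight[OF 0(1)] by simp
next
  case (Suc n s l)
  let ?P = "\<Prod>k<l. w (s k) (s (Suc k))"
  show ?case
  \<comment> \<open>If the prefix ends at -1, then \<open>\<tau> = l\<close> is forced, since a
    later \<open>\<tau>\<close> would have an earlier visit to -1.\<close>
  proof (cases "s l = -1")
    case True
    have "(\<forall>k\<le>l. S \<omega> k = s k) \<and> (\<exists>\<tau>\<in>{l..l + Suc n}. S \<omega> \<tau> = -1 \<and> (\<forall>k<\<tau>. S \<omega> k \<noteq> -1 \<and> G k \<omega>))
      \<longleftrightarrow> (\<forall>k\<le>l. S \<omega> k = s k) \<and> (\<forall>k<l. G k \<omega>)" for \<omega>
    proof (intro iffI conjI; (elim conjE bexE)?)
      fix \<tau> assume "\<forall>k\<le>l. S \<omega> k = s k" "\<tau> \<in> {l..l + Suc n}" "\<forall>k<\<tau>. S \<omega> k \<noteq> -1 \<and> G k \<omega>"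
      then show "\<forall>k<l. G k \<omega>" by auto
    next
      assume "\<forall>k\<le>l. S \<omega> k = s k" "\<forall>k<l. G k \<omega>"
      then show "\<exists>\<tau>\<in>{l..l + Suc n}. S \<omega> \<tau> = -1 \<and> (\<forall>k<\<tau>. S \<omega> k \<noteq> -1 \<and> G k \<omega>)"
        using True Suc.prems(2) by (intro bexI[of _ l]) auto
    qed
    then show ?thesis using weight[OF Suc.prems(1)] True by simp
  next
    case False
    \<comment> \<open>The prefix is prolonged by a step \<open>e\<close>. Almost surely
      \<open>e\<close> is 1 or -1, so the event splits into the disjoint events \<open>E 1\<close>
      and \<open>E (-1)\<close>.\<close>
    define s' where "s' e = s(Suc l := s l + e)" for e
    define H where "H \<omega> \<longleftrightarrow> (\<exists>\<tau>\<in>{Suc l..Suc l + n}. S \<omega> \<tau> = -1 \<and> (\<forall>k<\<tau>. S \<omega> k \<noteq> -1 \<and> G k \<omega>))" for \<omega>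
    define E where "E e = {\<omega> \<in> space M. (\<forall>k\<le>Suc l. S \<omega> k = s' e k) \<and> H \<omega>}" for e
    have [measurable]: "Measurable.pred M H"
      unfolding H_def[abs_def] by measurable
    have [measurable]: "E e \<in> events" for e
      unfolding E_def by measurable
    have prob_E: "prob (E e) = (1 / 2) ^ Suc l * (?P * w (s l) (s l + e)) * hit_weight w n (s l + e)"
      if "\<bar>e\<bar> = 1" for e
    proof -
      have "walk_path (s' e) (Suc l)" "\<And>k. k < Suc l \<Longrightarrow> s' e k \<noteq> -1"
        using Suc.prems False that by (auto simp: walk_path_def s'_def less_Suc_eq)
      from Suc.IH[OF this] show ?thesis
        by (simp add: E_def H_def s'_def)
    qed
    have H_iff: "(\<exists>\<tau>\<in>{l..l + Suc n}. S \<omega> \<tau> = -1 \<and> (\<forall>k<\<tau>. S \<omega> k \<noteq> -1 \<and> G k \<omega>)) \<longleftrightarrow> H \<omega>"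
      if "S \<omega> l = s l" for \<omega>
    proof -
      have "S \<omega> l \<noteq> -1" using that False by simp
      then show ?thesis unfolding H_def by (metis (no_types, lifting) add_Suc_shift atLeastAtMost_iff not_less_eq_eq order_antisym_conv Suc_leD)
    qed
    have "\<P>(\<omega> in M. (\<forall>k\<le>l. S \<omega> k = s k) \<and>
      (\<exists>\<tau>\<in>{l..l + Suc n}. S \<omega> \<tau> = -1 \<and> (\<forall>k<\<tau>. S \<omega> k \<noteq> -1 \<and> G k \<omega>))) = prob (E 1 \<union> E (-1))"
    proof (rule finite_measure_eq_AE)
      show "AE \<omega> in M. \<omega> \<in> {\<omega> \<in> space M. (\<forall>k\<le>l. S \<omega> k = s k) \<and>
        (\<exists>\<tau>\<in>{l..l + Suc n}. S \<omega> \<tau> = -1 \<and> (\<forall>k<\<tau>. S \<omega> k \<noteq> -1 \<and> G k \<omega>))} \<longleftrightarrow> \<omega> \<in> E 1 \<union> E (-1)"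
        using simple_random_walk_step(1)[OF S]
      proof eventually_elim
        case (elim \<omega>)
        then have "S \<omega> (Suc l) = S \<omega> l + 1 \<or> S \<omega> (Suc l) = S \<omega> l + (-1)"
          by (smt (verit))
        then show ?case using H_iff[of \<omega>] by (auto simp: E_def s'_def le_Suc_eq)
      qed
    qed measurable
    also have "\<dots> = prob (E 1) + prob (E (-1))"
      by (rule finite_measure_Union) (auto simp: E_def s'_def)
    also have "\<dots> = (1 / 2) ^ l * ?P * hit_weight w (Suc n) (s l)"
      using False by (simp add: prob_E algebra_simps add_divide_distrib)
    finally show ?thesis .
  qed
qed

text \<open>Start from the prefix of length 0, which only fixes the starting point, and let the
  number of steps grow: the events increase, so continuity from below applies.\<close>

lemma prob_hit:
  assumes S: "simple_random_walk M S"
    and [measurable]: "\<And>k. (\<lambda>\<omega>. S \<omega> k) \<in> M \<rightarrow>\<^sub>M count_space UNIV" "\<And>k. Measurable.pred M (G k)"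
    and weight: "\<And>s l. walk_path s l \<Longrightarrow>
      \<P>(\<omega> in M. (\<forall>k\<le>l. S \<omega> k = s k) \<and> (\<forall>k<l. G k \<omega>)) = (1 / 2) ^ l * (\<Prod>k<l. w (s k) (s (Suc k)))"
    and lim: "(\<lambda>n. hit_weight w n 0) \<longlonglongrightarrow> p"
  shows "\<P>(\<omega> in M. \<exists>\<tau>. S \<omega> \<tau> = -1 \<and> (\<forall>k<\<tau>. S \<omega> k \<noteq> -1 \<and> G k \<omega>)) = p"
proof -
  define A where "A n = {\<omega> \<in> space M. S \<omega> 0 = 0 \<and>
      (\<exists>\<tau>\<in>{0..n}. S \<omega> \<tau> = -1 \<and> (\<forall>k<\<tau>. S \<omega> k \<noteq> -1 \<and> G k \<omega>))}" for n
  have [measurable]: "A n \<in> events" for n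
    unfolding A_def by measurable
  have "prob (A n) = hit_weight w n 0" for n
    using prob_cylinder_hit[OF S assms(2,3) weight, of "\<lambda>_. 0" 0 n] by (simp add: A_def walk_path_def)
  moreover have "(\<lambda>n. prob (A n)) \<longlonglongrightarrow> prob (\<Union>n. A n)"
    by (rule finite_Lim_measure_incseq) (force simp: incseq_def A_def)+
  ultimately have "prob (\<Union>n. A n) = p"
    using lim LIMSEQ_unique by simp blast
  moreover have "prob (\<Union>n. A n) = \<P>(\<omega> in M. \<exists>\<tau>. S \<omega> \<tau> = -1 \<and> (\<forall>k<\<tau>. S \<omega> k \<noteq> -1 \<and> G k \<omega>))"
  proof (rule finite_measure_eq_AE)
    have "AE \<omega> in M. S \<omega> 0 = 0" using S by (simp add: simple_random_walk_def)
    then show "AE \<omega> in M. \<omega> \<in> (\<Union>n. A n) \<longleftrightarrow>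
      \<omega> \<in> {\<omega> \<in> space M. \<exists>\<tau>. S \<omega> \<tau> = -1 \<and> (\<forall>k<\<tau>. S \<omega> k \<noteq> -1 \<and> G k \<omega>)}"
      by eventually_elim (fastforce simp: A_def)
  qed measurable
  ultimately show ?thesis by simp
qed

text \<open>The case of \<open>prob_hit\<close> with trivial events and unit weights, whose limit is
  1 by recurrence.\<close>

lemma AE_hit:
  assumes S: "simple_random_walk M S"
    and [measurable]: "\<And>k. (\<lambda>\<omega>. S \<omega> k) \<in> M \<rightarrow>\<^sub>M count_space UNIV"
  shows "AE \<omega> in M. \<exists>\<tau>. S \<omega> \<tau> = -1"
proof -
  have "\<P>(\<omega> in M. \<exists>\<tau>. S \<omega> \<tau> = -1 \<and> (\<forall>k<\<tau>. S \<omega> k \<noteq> -1 \<and> True)) = 1"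
    by (rule prob_hit[OF S assms(2) _ _ hit_weight_1_tendsto])
       (simp_all add: prob_cylinder[OF S assms(2), unfolded cylinder_def])
  from AE_prob_1[OF this] show ?thesis
    by eventually_elim auto
qed

text \<open>Almost surely there is a first visit \<open>\<tau>\<close> to -1; then a bad index
  before \<open>\<tau>\<close> is exactly the complement of the event in \<open>prob_hit\<close>.
  This is the shape in which both maxima reach level \<open>m\<close>.\<close>

lemma prob_bad_before_hit:
  assumes S: "simple_random_walk M S"
    and [measurable]: "\<And>k. (\<lambda>\<omega>. S \<omega> k) \<in> M \<rightarrow>\<^sub>M count_space UNIV" "\<And>k. Measurable.pred M (G k)"
    and weight: "\<And>s l. walk_path s l \<Longrightarrow>
      \<P>(\<omega> in M. (\<forall>k\<le>l. S \<omega> k = s k) \<and> (\<forall>k<l. G k \<omega>)) = (1 / 2) ^ l * (\<Prod>k<l. w (s k) (s (Suc k)))"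
    and lim: "(\<lambda>n. hit_weight w n 0) \<longlonglongrightarrow> p"
  shows "\<P>(\<omega> in M. \<exists>n. (\<forall>k\<le>n. S \<omega> k \<noteq> -1) \<and> \<not> G n \<omega>) = 1 - p"
proof -
  define Q where "Q \<omega> \<longleftrightarrow> (\<exists>\<tau>. S \<omega> \<tau> = -1 \<and> (\<forall>k<\<tau>. S \<omega> k \<noteq> -1 \<and> G k \<omega>))" for \<omega>
  have [measurable]: "Measurable.pred M Q" unfolding Q_def[abs_def] by measurable
  have "\<P>(\<omega> in M. \<exists>n. (\<forall>k\<le>n. S \<omega> k \<noteq> -1) \<and> \<not> G n \<omega>) = \<P>(\<omega> in M. \<not> Q \<omega>)"
  proof (rule finite_measure_eq_AE)
    show "AE \<omega> in M. \<omega> \<in> {\<omega> \<in> space M. \<exists>n. (\<forall>k\<le>n. S \<omega> k \<noteq> -1) \<and> \<not> G n \<omega>} \<longleftrightarrow>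
      \<omega> \<in> {\<omega> \<in> space M. \<not> Q \<omega>}"
      using AE_hit[OF S assms(2)]
    proof eventually_elim
      case (elim \<omega>)
      define \<tau> where "\<tau> = (LEAST \<tau>. S \<omega> \<tau> = -1)"
      have \<tau>: "S \<omega> \<tau> = -1" "\<And>k. k < \<tau> \<Longrightarrow> S \<omega> k \<noteq> -1"
        using LeastI_ex[OF elim] not_less_Least unfolding \<tau>_def by blast+
      have "Q \<omega> \<longleftrightarrow> (\<forall>k<\<tau>. G k \<omega>)"
        unfolding Q_def using \<tau> by (metis linorder_neqE_nat)
      moreover have "(\<forall>k\<le>n. S \<omega> k \<noteq> -1) \<longleftrightarrow> n < \<tau>" for n
        using \<tau> by (meson leI le_less_trans)
      ultimately show ?case by auto
    qed
  qed measurable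
  also have "\<dots> = 1 - p"
    using prob_hit[OF S assms(2,3) weight lim] by (subst prob_neg) (simp_all add: Q_def)
  finally show ?thesis .
qed

end

subsection \<open>Treed bridges\<close>

text \<open>On the bridge event \<open>B\<close> every index \<open>\<iota> i\<close> is a down-step
  of prescribed height, so the conditional probability given \<open>b\<close> is almost surely
  constant there. The event belongs to the sigma-algebra of \<open>b\<close>, and integrating the
  constant over it gives the product.\<close>

lemma (in prob_space) prob_treed_event:
  assumes "uniform_infinite_treed_bridge M b T"
    and K: "finite K" "inj_on \<iota> K"
    and B: "B \<in> sets path_space" "\<And>w i. w \<in> B \<Longrightarrow> i \<in> K \<Longrightarrow> \<iota> i \<in> DS w \<and> w (\<iota> i) = c i"
  shows "\<P>(\<omega> in M. b \<omega> \<in> B \<and> (\<forall>i\<in>K. T \<omega> (\<iota> i) \<in> A))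
    = \<P>(\<omega> in M. b \<omega> \<in> B) * (\<Prod>i\<in>K. measure (rho (c i)) A)"
proof -
  define F where "F = vimage_algebra (space M) b path_space"
  define J where "J = \<iota> ` K"
  define X where "X = {\<omega> \<in> space M. \<forall>i\<in>J. T \<omega> i \<in> A}"
  define C where "C = b -` B \<inter> space M"
  have b: "b \<in> M \<rightarrow>\<^sub>M path_space"
    and T [measurable]: "\<And>i. (\<lambda>\<omega>. T \<omega> i) \<in> M \<rightarrow>\<^sub>M count_space UNIV"
    using assms(1) by (simp_all add: uniform_infinite_treed_bridge_def two_sided_walk_def)
  have "finite J" using K(1) by (simp add: J_def)
  then have cond: "AE \<omega> in M. J \<subseteq> DS (b \<omega>) \<longrightarrow>
      real_cond_exp M F (indicator X) \<omega> = (\<Prod>i\<in>J. measure (rho (b \<omega> i)) A)"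
    using assms(1)[unfolded uniform_infinite_treed_bridge_def, THEN conjunct2, THEN conjunct2,
      THEN conjunct2, rule_format, of J "\<lambda>_. A"]
    unfolding F_def X_def by simp
  have X [measurable]: "X \<in> events"
  proof -
    have [measurable]: "Measurable.pred M (\<lambda>\<omega>. T \<omega> i \<in> A)" for i
      using measurable_compose[OF T, of "\<lambda>t. t \<in> A"] by simp
    show ?thesis unfolding X_def using \<open>finite J\<close> by measurable
  qed
  have "subalgebra M F"
    using sets_image_in_sets[OF refl b] by (simp add: subalgebra_def F_def)
  then interpret F: finite_measure_subalgebra M F
    by unfold_locales
  have C_F: "C \<in> sets F" unfolding C_def F_def using B(1) by (rule in_vimage_algebra)
  have C [measurable]: "C \<in> events" unfolding C_def using b B(1) by (rule measurable_sets)
  have prod: "(\<Prod>i\<in>J. measure (rho (b \<omega> i)) A) = (\<Prod>i\<in>K. measure (rho (c i)) A)" "J \<subseteq> DS (b \<omega>)"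
    if "\<omega> \<in> C" for \<omega>
    using that B(2)[of "b \<omega>"] by (auto simp: J_def C_def prod.reindex[OF K(2)] intro!: prod.cong)
  have "prob (C \<inter> X) = (LINT \<omega>:C|M. indicator X \<omega>)"
    by (simp add: set_lebesgue_integral_def indicator_inter_arith[symmetric])
  \<comment> \<open>Defining property of conditional expectation, available because \<open>C\<close>
    lies in \<open>F\<close>.\<close>
  also have "\<dots> = (LINT \<omega>:C|M. real_cond_exp M F (indicator X) \<omega>)"
    by (rule F.real_cond_exp_intA) (simp_all add: C_F integrable_real_indicator emeasure_eq_measure)
  also have "\<dots> = (LINT \<omega>:C|M. (\<Prod>i\<in>K. measure (rho (c i)) A))"
    using cond by (intro set_lebesgue_integral_cong_AE) (auto simp: prod)
  also have "\<dots> = prob C * (\<Prod>i\<in>K. measure (rho (c i)) A)"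
    by (simp add: set_lebesgue_integral_def)
  finally have "prob (C \<inter> X) = prob C * (\<Prod>i\<in>K. measure (rho (c i)) A)" .
  moreover have "C \<inter> X = {\<omega> \<in> space M. b \<omega> \<in> B \<and> (\<forall>i\<in>K. T \<omega> (\<iota> i) \<in> A)}"
    "C = {\<omega> \<in> space M. b \<omega> \<in> B}"
    by (auto simp: C_def X_def J_def)
  ultimately show ?thesis by simp
qed

text \<open>One statement for both sides of the bridge: \<open>\<kappa>\<close> gives the direction
  of time, \<open>D\<close> tells which steps carry a tree, \<open>\<iota>\<close> where that tree
  sits and \<open>c\<close> its root label. It supplies the \<open>weight\<close> hypothesis of the
  hitting lemmas.\<close>

lemma (in prob_space) prob_treed_path:
  fixes \<kappa> \<iota> :: "nat \<Rightarrow> int" and D :: "int \<Rightarrow> int \<Rightarrow> bool"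
  assumes bridge: "uniform_infinite_treed_bridge M b T"
    and S: "simple_random_walk M (\<lambda>\<omega> n. b \<omega> (\<kappa> n))"
    and \<iota>: "inj \<iota>"
    and D: "\<And>w k. D (w (\<kappa> k)) (w (\<kappa> (Suc k))) \<Longrightarrow> \<iota> k \<in> DS w \<and> w (\<iota> k) = c (w (\<kappa> k)) (w (\<kappa> (Suc k)))"
    and s: "walk_path s l"
  shows "\<P>(\<omega> in M. (\<forall>k\<le>l. b \<omega> (\<kappa> k) = s k) \<and>
      (\<forall>k<l. D (b \<omega> (\<kappa> k)) (b \<omega> (\<kappa> (Suc k))) \<longrightarrow> T \<omega> (\<iota> k) \<in> A))
    = (1 / 2) ^ l * (\<Prod>k<l. if D (s k) (s (Suc k)) then measure (rho (c (s k) (s (Suc k)))) A else 1)"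
proof -
  define K where "K = {k. k < l \<and> D (s k) (s (Suc k))}"
  define B where "B = {w \<in> space path_space. \<forall>k\<le>l. w (\<kappa> k) = s k}"
  have b [measurable]: "b \<in> M \<rightarrow>\<^sub>M path_space"
    using bridge by (simp add: uniform_infinite_treed_bridge_def two_sided_walk_def)
  have b_i [measurable]: "(\<lambda>\<omega>. b \<omega> i) \<in> M \<rightarrow>\<^sub>M count_space UNIV" for i
    using measurable_compose[OF b measurable_component_singleton, of i] by simp
  have B: "B \<in> sets path_space" unfolding B_def by measurable
  have BK: "\<iota> i \<in> DS w \<and> w (\<iota> i) = c (s i) (s (Suc i))" if "w \<in> B" "i \<in> K" for w i
  proof -
    have "w (\<kappa> i) = s i" "w (\<kappa> (Suc i)) = s (Suc i)" using that by (auto simp: B_def K_def)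
    then show ?thesis using D[of w i] that(2) by (simp add: K_def)
  qed
  have K: "finite K" "inj_on \<iota> K"
    using \<iota> by (auto simp: K_def intro: inj_on_subset)
  \<comment> \<open>Once the path agrees with \<open>s\<close>, the random set of tree-carrying
    steps becomes the fixed set \<open>K\<close>.\<close>
  have "\<P>(\<omega> in M. (\<forall>k\<le>l. b \<omega> (\<kappa> k) = s k) \<and>
      (\<forall>k<l. D (b \<omega> (\<kappa> k)) (b \<omega> (\<kappa> (Suc k))) \<longrightarrow> T \<omega> (\<iota> k) \<in> A))
    = \<P>(\<omega> in M. b \<omega> \<in> B \<and> (\<forall>i\<in>K. T \<omega> (\<iota> i) \<in> A))"
    by (intro arg_cong[of _ _ prob] Collect_cong)
       (auto simp: B_def K_def space_PiM)
  also have "\<dots> = \<P>(\<omega> in M. b \<omega> \<in> B) * (\<Prod>i\<in>K. measure (rho (c (s i) (s (Suc i)))) A)"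
    by (rule prob_treed_event[OF bridge K B BK])
  also have "\<P>(\<omega> in M. b \<omega> \<in> B) = prob (cylinder M (\<lambda>\<omega> n. b \<omega> (\<kappa> n)) s l)"
    by (simp add: B_def cylinder_def space_PiM)
  also have "\<dots> = (1 / 2) ^ l"
    by (rule prob_cylinder[OF S b_i s])
  also have "(\<Prod>i\<in>K. measure (rho (c (s i) (s (Suc i)))) A)
    = (\<Prod>k<l. if D (s k) (s (Suc k)) then measure (rho (c (s k) (s (Suc k)))) A else 1)"
  proof -
    have "K = {k \<in> {..<l}. D (s k) (s (Suc k))}" by (auto simp: K_def)
    then show ?thesis by (simp only: prod.inter_filter[OF finite_lessThan])
  qed
  finally show ?thesis .
qed

section \<open>Rewriting the events on the maxima in terms of walk and trees\<close>

lemma ereal_le_SUP_int_iff: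
  "ereal (real m) \<le> (SUP i\<in>I. ereal (of_int (f i))) \<longleftrightarrow> (\<exists>i\<in>I. int m \<le> f i)"
proof
  assume le: "ereal (real m) \<le> (SUP i\<in>I. ereal (of_int (f i)))"
  show "\<exists>i\<in>I. int m \<le> f i"
  proof (rule ccontr)
    assume "\<not> ?thesis"
    \<comment> \<open>Integrality sharpens "below \<open>m\<close>" to "at most
      \<open>m - 1\<close>", a bound that survives the supremum even over an empty or infinite
      set.\<close>
    then have "(SUP i\<in>I. ereal (of_int (f i))) \<le> ereal (of_int (int m - 1))"
      by (intro SUP_least) (force simp del: of_int_diff)
    also have "\<dots> < ereal (real m)" by simp
    finally show False using le by simp
  qed
next
  assume "\<exists>i\<in>I. int m \<le> f i"
  then obtain i where i: "i \<in> I" "int m \<le> f i" by blast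
  show "ereal (real m) \<le> (SUP i\<in>I. ereal (of_int (f i)))"
    by (rule SUP_upper2[OF i(1)]) (use i(2) in simp)
qed

lemma le_neg_Min_labels_iff: "int m \<le> - Min (vertex_labels t) \<longleftrightarrow> t \<notin> labels_above (- int m)"
proof -
  have "finite (vertex_labels t)" by (induction t) auto
  moreover have "vertex_labels t \<noteq> {}" by (cases t) auto
  ultimately have "Min (vertex_labels t) \<le> - int m \<longleftrightarrow> (\<exists>x\<in>vertex_labels t. x \<le> - int m)"
    by (rule Min_le_iff)
  then show ?thesis by (auto simp: labels_above_def not_less)
qed

lemma less_H1_iff: "ereal (of_int (int n)) < H1 w \<longleftrightarrow> (\<forall>k\<le>n. w (int k) \<noteq> -1)"
proof
  assume less: "ereal (of_int (int n)) < H1 w"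
  show "\<forall>k\<le>n. w (int k) \<noteq> -1"
  proof (intro allI impI notI)
    fix k assume k: "k \<le> n" "w (int k) = -1"
    have "H1 w \<le> ereal (of_int (int k))"
      unfolding H1_def using k by (intro Inf_lower CollectI exI[of _ "int k"]) simp
    also have "\<dots> \<le> ereal (of_int (int n))" using k by simp
    finally show False using less by simp
  qed
next
  assume no_hit: "\<forall>k\<le>n. w (int k) \<noteq> -1"
  \<comment> \<open>The detour through \<open>n + 1\<close> makes the inequality strict: all hits
    come at time \<open>n + 1\<close> or later, including the case of no hit at all.\<close>
  have "ereal (of_int (int n)) < ereal (of_int (int n + 1))" by simp
  also have "\<dots> \<le> H1 w"
    unfolding H1_def
  proof (rule Inf_greatest, clarsimp)
    fix m :: int assume m: "0 \<le> m" "w m = -1"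
    then have "\<not> nat m \<le> n" using no_hit by (metis int_nat_eq)
    then show "real n + 1 \<le> real_of_int m" by linarith
  qed
  finally show "ereal (of_int (int n)) < H1 w" .
qed

lemma ex_neg_int_iff: "(\<exists>i<0. P i) \<longleftrightarrow> (\<exists>n. P (- int (Suc n)))"
proof
  assume "\<exists>i<0. P i"
  then obtain i where "i < 0" "P i" by blast
  then have "P (- int (Suc (nat (- i - 1))))" by simp
  then show "\<exists>n. P (- int (Suc n))" by (rule exI)
qed (metis negative_zless_0)

lemma ex_nonneg_int_iff: "(\<exists>i\<ge>0. P i) \<longleftrightarrow> (\<exists>n. P (int n))"
proof
  assume "\<exists>i\<ge>0. P i"
  then obtain i where "i \<ge> 0" "P i" by blast
  then have "P (int (nat i))" by simp
  then show "\<exists>n. P (int n)" by (rule exI)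
qed (metis of_nat_0_le_iff)

text \<open>The index range on the negative side contains \<open>H1'\<close> itself, so a visit to
  -1 exactly at time \<open>- (n + 1)\<close> is permitted and only the times from
  \<open>- n\<close> to 0 are constrained.\<close>

lemma H1'_le_iff: "H1' w \<le> ereal (of_int (- int (Suc n))) \<longleftrightarrow> (\<forall>k\<le>n. w (- int k) \<noteq> -1)"
proof -
  have "H1' w \<le> ereal (of_int (- int (Suc n))) \<longleftrightarrow> \<not> (\<exists>i\<ge>0. w (- i) = -1 \<and> i \<le> int n)"
  proof
    assume le: "H1' w \<le> ereal (of_int (- int (Suc n)))"
    show "\<not> (\<exists>i\<ge>0. w (- i) = -1 \<and> i \<le> int n)"
    proof
      assume "\<exists>i\<ge>0. w (- i) = -1 \<and> i \<le> int n"
      then obtain i where i: "0 \<le> i" "w (- i) = -1" "i \<le> int n" by blast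
      have "ereal (of_int (- i)) \<le> H1' w"
        unfolding H1'_def using i by (intro Sup_upper CollectI exI[of _ "- i"]) simp
      then have "ereal (of_int (- i)) \<le> ereal (of_int (- int (Suc n)))"
        using le by (rule order_trans)
      then show False using i(3) by simp
    qed
  next
    assume no_hit: "\<not> (\<exists>i\<ge>0. w (- i) = -1 \<and> i \<le> int n)"
    show "H1' w \<le> ereal (of_int (- int (Suc n)))"
      unfolding H1'_def
    proof (rule Sup_least, elim CollectE exE conjE)
      fix x m assume "x = ereal (of_int m)" "m \<le> 0" "w m = -1"
      moreover from this have "\<not> - m \<le> int n" using no_hit[simplified, rule_format, of "- m"] by auto
      then have "m \<le> - int (Suc n)" by simp
      ultimately show "x \<le> ereal (of_int (- int (Suc n)))"
        by (simp only: ereal_less_eq of_int_le_iff)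
    qed
  qed
  also have "\<dots> \<longleftrightarrow> (\<forall>k\<le>n. w (- int k) \<noteq> -1)"
    unfolding ex_nonneg_int_iff by auto
  finally show ?thesis .
qed

lemma le_Delta0_iff:
  "ereal (real m) \<le> Delta0 w t \<longleftrightarrow>
    (\<exists>n. (\<forall>k\<le>n. w (int k) \<noteq> -1) \<and>
      \<not> (w (int (Suc n)) = w (int n) - 1 \<longrightarrow> t (int n) \<in> labels_above (- int m)))"
proof -
  have "ereal (real m) \<le> Delta0 w t \<longleftrightarrow>
    (\<exists>i\<ge>0. i \<in> DS w \<and> ereal (of_int i) < H1 w \<and> t i \<notin> labels_above (- int m))"
    unfolding Delta0_def ereal_le_SUP_int_iff le_neg_Min_labels_iff by blast
  also have "\<dots> \<longleftrightarrow> (\<exists>n. int n \<in> DS w \<and> (\<forall>k\<le>n. w (int k) \<noteq> -1) \<and> t (int n) \<notin> labels_above (- int m))"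
    unfolding ex_nonneg_int_iff less_H1_iff ..
  finally show ?thesis
    by (simp add: DS_def add.commute) blast
qed

text \<open>A down-step of the bridge from \<open>- (n + 1)\<close> to \<open>- n\<close> is an
  up-step of the reversed walk, and its tree sits at the endpoint \<open>- (n + 1)\<close>, that is,
  at the upper end.\<close>

lemma le_Delta0'_iff:
  "ereal (real m) \<le> Delta0' w t \<longleftrightarrow>
    (\<exists>n. (\<forall>k\<le>n. w (- int k) \<noteq> -1) \<and>
      \<not> (w (- int (Suc n)) = w (- int n) + 1 \<longrightarrow> t (- int (Suc n)) \<in> labels_above (- int m)))"
proof -
  have DS_iff: "- int (Suc n) \<in> DS w \<longleftrightarrow> w (- int (Suc n)) = w (- int n) + 1" for n
    by (auto simp: DS_def)
  have "ereal (real m) \<le> Delta0' w t \<longleftrightarrow>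
    (\<exists>i<0. i \<in> DS w \<and> H1' w \<le> ereal (of_int i) \<and> t i \<notin> labels_above (- int m))"
    unfolding Delta0'_def ereal_le_SUP_int_iff le_neg_Min_labels_iff by blast
  also have "\<dots> \<longleftrightarrow> (\<exists>n. - int (Suc n) \<in> DS w \<and> (\<forall>k\<le>n. w (- int k) \<noteq> -1) \<and>
      t (- int (Suc n)) \<notin> labels_above (- int m))"
    unfolding ex_neg_int_iff H1'_le_iff ..
  finally show ?thesis unfolding DS_iff by blast
qed

theorem proposition1:
  fixes M :: "'a measure"
    and b :: "'a \<Rightarrow> int \<Rightarrow> int"
    and T :: "'a \<Rightarrow> int \<Rightarrow> int plane_tree"
    and m :: nat
  assumes "uniform_infinite_treed_bridge M b T"
    and "m \<ge> 1"
  shows "\<P>(\<omega> in M. Delta0 (b \<omega>) (T \<omega>) \<ge> ereal (real m)) = 1 / (real m + 1)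
       \<and> \<P>(\<omega> in M. Delta0' (b \<omega>) (T \<omega>) \<ge> ereal (real m)) = 1 / (real m + 3)"
proof -
  interpret prob_space M
    using assms(1) by (simp add: uniform_infinite_treed_bridge_def)
  have b [measurable]: "b \<in> M \<rightarrow>\<^sub>M path_space"
    and S: "simple_random_walk M (\<lambda>\<omega> n. b \<omega> (int n))"
    and S': "simple_random_walk M (\<lambda>\<omega> n. b \<omega> (- int n))"
    and T [measurable]: "\<And>i. (\<lambda>\<omega>. T \<omega> i) \<in> M \<rightarrow>\<^sub>M count_space UNIV"
    using assms(1) by (simp_all add: uniform_infinite_treed_bridge_def two_sided_walk_def)
  have b_i [measurable]: "(\<lambda>\<omega>. b \<omega> i) \<in> M \<rightarrow>\<^sub>M count_space UNIV" for i
    using measurable_compose[OF b measurable_component_singleton, of i] by simp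
  define A where "A = labels_above (- int m)"
  have [measurable]: "Measurable.pred M (\<lambda>\<omega>. T \<omega> i \<in> A)" for i
    using measurable_compose[OF T, of "\<lambda>t. t \<in> A"] by simp
  define a where "a k = measure (rho k) A" for k
  have a01: "0 \<le> a k" "a k \<le> 1" for k
    unfolding a_def A_def by (rule rho_labels_above_bounds)+
  have a: "a k = (k + m) * (k + m + 3) / ((k + m + 1) * (k + m + 2))" if "k \<ge> 0" for k :: int
    using rho_labels_above[of "- int m" k] that by (simp add: a_def A_def)

  \<comment> \<open>A down-step from \<open>x\<close> carries a tree with root label
    \<open>x\<close>; other steps cost nothing.\<close>
  define w where "w x y = (if y = x - 1 then a x else 1)" for x y
  \<comment> \<open>The solution is normalized by \<open>h (-1) = 1\<close>, where
    \<open>m \<ge> 1\<close> avoids a zero denominator, and satisfies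
    \<open>1 - h 0 = 1 / (m + 1)\<close>.\<close>
  define h where "h x = m / (m + x + 1)" for x :: int
  have lim: "(\<lambda>n. hit_weight w n 0) \<longlonglongrightarrow> h 0"
  proof (rule hit_weight_tendsto)
    fix x :: int assume "x \<ge> 0"
    define y where "y = real_of_int x + m"
    have "y > 0" using \<open>x \<ge> 0\<close> assms(2) by (simp add: y_def)
    have eqs: "h x = m / (y + 1)" "h (x + 1) = m / (y + 2)" "h (x - 1) = m / y"
      "a x = y * (y + 3) / ((y + 1) * (y + 2))"
      using a[OF \<open>x \<ge> 0\<close>] by (simp_all add: h_def y_def algebra_simps)
    show "h x = (w x (x + 1) * h (x + 1) + w x (x - 1) * h (x - 1)) / 2"
      using \<open>y > 0\<close> unfolding w_def eqs by (simp add: divide_simps) (simp add: algebra_simps)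
  qed (use assms(2) in \<open>auto simp: w_def h_def a01 divide_simps\<close>)
  have "\<P>(\<omega> in M. ereal (real m) \<le> Delta0 (b \<omega>) (T \<omega>)) = 1 - h 0"
    unfolding le_Delta0_iff A_def[symmetric]
  proof (rule prob_bad_before_hit[OF S _ _ _ lim])
    fix s l assume "walk_path s l"
    from prob_treed_path[OF assms(1) S inj_of_nat _ this,
        where D = "\<lambda>x y. y = x - 1" and c = "\<lambda>x y. x" and A = A]
    show "\<P>(\<omega> in M. (\<forall>k\<le>l. b \<omega> (int k) = s k) \<and>
        (\<forall>k<l. b \<omega> (int (Suc k)) = b \<omega> (int k) - 1 \<longrightarrow> T \<omega> (int k) \<in> A))
      = (1 / 2) ^ l * (\<Prod>k<l. w (s k) (s (Suc k)))"
      unfolding w_def a_def by (simp add: DS_def algebra_simps)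
  qed measurable

  \<comment> \<open>For the reversed walk the tree belongs to an up-step and is rooted at its end
    \<open>y = x + 1\<close>, so the weight is taken at the new height.\<close>
  define w' where "w' x y = (if y = x + 1 then a y else 1)" for x y
  \<comment> \<open>Again \<open>h' (-1) = 1\<close>, and now
    \<open>1 - h' 0 = 1 / (m + 3)\<close>.\<close>
  define h' where "h' x = (m + 2) / (m + x + 3)" for x :: int
  have lim': "(\<lambda>n. hit_weight w' n 0) \<longlonglongrightarrow> h' 0"
  proof (rule hit_weight_tendsto)
    fix x :: int assume "x \<ge> 0"
    \<comment> \<open>The extra 1 accounts for the root at height \<open>x + 1\<close>; it gives
      \<open>a (x + 1)\<close> the same form in \<open>y\<close> as \<open>a x\<close> had on the
      forward side.\<close>
    define y where "y = real_of_int x + m + 1"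
    have "y > 0" using \<open>x \<ge> 0\<close> by (simp add: y_def)
    have eqs: "h' x = (m + 2) / (y + 2)" "h' (x + 1) = (m + 2) / (y + 3)" "h' (x - 1) = (m + 2) / (y + 1)"
      "a (x + 1) = y * (y + 3) / ((y + 1) * (y + 2))"
      using a[of "x + 1"] \<open>x \<ge> 0\<close> by (simp_all add: h'_def y_def algebra_simps)
    show "h' x = (w' x (x + 1) * h' (x + 1) + w' x (x - 1) * h' (x - 1)) / 2"
      using \<open>y > 0\<close> unfolding w'_def eqs by (simp add: divide_simps) (simp add: algebra_simps)
  qed (use assms(2) in \<open>auto simp: w'_def h'_def a01 divide_simps\<close>)
  have "\<P>(\<omega> in M. ereal (real m) \<le> Delta0' (b \<omega>) (T \<omega>)) = 1 - h' 0"
    unfolding le_Delta0'_iff A_def[symmetric]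
  proof (rule prob_bad_before_hit[OF S' _ _ _ lim'])
    fix s l assume "walk_path s l"
    from prob_treed_path[OF assms(1) S' _ _ this,
        where \<iota> = "\<lambda>k. - int (Suc k)" and D = "\<lambda>x y. y = x + 1" and c = "\<lambda>x y. y" and A = A]
    show "\<P>(\<omega> in M. (\<forall>k\<le>l. b \<omega> (- int k) = s k) \<and>
        (\<forall>k<l. b \<omega> (- int (Suc k)) = b \<omega> (- int k) + 1 \<longrightarrow> T \<omega> (- int (Suc k)) \<in> A))
      = (1 / 2) ^ l * (\<Prod>k<l. w' (s k) (s (Suc k)))"
      unfolding w'_def a_def by (simp add: DS_def algebra_simps inj_def)
  qed measurable
  with \<open>\<P>(\<omega> in M. ereal (real m) \<le> Delta0 (b \<omega>) (T \<omega>)) = 1 - h 0\<close> show ?thesis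
    by (simp add: h_def h'_def field_simps)
qed

end
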